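(* Given $1\le j\le n+2$, there is an $r\in\{1,\dots,n+2\}\setminus\{j\}$ such that $\Phi_{r,j}\neq0$. In particular, $c_j=d-b_j$, where $d=\sum_{j=1}^{n+2}b_j-\sum_{i=1}^na_i$.
   Context: Let $\mathbb{K}$ be an algebraically closed field, $R=\mathbb{K}[x,y,z]$ with the standard grading, $n>0$ an integer, and $a_1\le a_2\le\cdots\le a_n$, $b_1\le b_2\le\cdots\le b_{n+2}$ integers. Let $\varphi:\bigoplus_{j=1}^{n+2}R(-b_j)\to\bigoplus_{i=1}^nR(-a_i)$ be a degree-zero graded $R$-linear map with matrix $(\varphi_{i,j})$, such that each entry $\varphi_{i,j}$ is either $0$ or homogeneous of positive degree (necessarily equal to $b_j-a_i$). Let $I\subset R$ be the ideal generated by the $n\times n$ minors of $\varphi$, and assume that $I$ has codimension $3$. Let $M=\operatorname{coker}(\varphi)$; it is a graded $R$-module of finite length. For $r\ne j$ in $\{1,\dots,n+2\}$, $\Phi_{r,j}$ denotes the $n\times n$ minor of $\varphi$ obtained by deleting columns $r$ and $j$. The minimal graded free resolution of $M$ is given by the Buchsbaum–Rim complex $$0\to\bigoplus_{i=1}^nR(-d_i)\xrightarrow{\ \delta\ }\bigoplus_{j=1}^{n+2}R(-c_j)\xrightarrow{\ \varepsilon\ }\bigoplus_{j=1}^{n+2}R(-b_j)\xrightarrow{\ \varphi\ }\bigoplus_{i=1}^nR(-a_i),$$ where in the standard bases the $(r,j)$ entry of $\varepsilon$ is $(-1)^{n-r+1}\Phi_{r,j}$ if $r<j$, $0$ if $r=j$,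 and $(-1)^{n-r}\Phi_{r,j}$ if $r>j$; and the $(j,i)$ entry of $\delta$ is $(-1)^{j+1}\varphi_{i,j}$. The integers $c_j,d_i$ are the degrees of the corresponding basis elements, so that $\varepsilon$ and $\delta$ are homogeneous of degree zero. *)

theory Defs
  imports
    "HOL-Library.Poly_Mapping"
    "HOL-Library.Numeral_Type"
    "HOL-Library.Extended_Nat"
    "HOL-Computational_Algebra.Polynomial"
    "HOL-Algebra.Ideal"
    "Jordan_Normal_Form.Determinant"
    "Jordan_Normal_Form.DL_Submatrix"
    "Jordan_Normal_Form.VS_Connect"
begin

text \<open>
  The ring $K[x,y,z]$: finitely supported maps from monomials to coefficients, where a monomial
  is a finitely supported exponent vector indexed by the three-element type \<^typ>\<open>3\<close>;
  multiplication is convolution.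
\<close>

type_synonym 'k poly3 = "(3 \<Rightarrow>\<^sub>0 nat) \<Rightarrow>\<^sub>0 'k"

definition monom_degree :: "(3 \<Rightarrow>\<^sub>0 nat) \<Rightarrow> nat" where
  "monom_degree m = (\<Sum>i\<in>UNIV. Poly_Mapping.lookup m i)"

text \<open>
  Membership in the graded piece of degree \<open>e\<close>. Zero belongs to every graded piece, and the
  pieces of negative degree contain only zero.
\<close>

definition homogeneous :: "int \<Rightarrow> 'k::zero poly3 \<Rightarrow> bool" where
  "homogeneous e p \<longleftrightarrow> (\<forall>m\<in>Poly_Mapping.keys p. int (monom_degree m) = e)"

text \<open>
  The matrix \<open>A\<close> defines a degree-zero graded map from the direct sum of the \<open>R(-s j)\<close> to the
  direct sum of the \<open>R(-t i)\<close>: the \<open>j\<close>-th source generator has degree \<open>s j\<close> and the \<open>i\<close>-th target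
  generator has degree \<open>t i\<close>. The target degrees come first, as in the row-column order. All
  indices of matrices and of degree sequences start at 0.
\<close>

definition graded_matrix :: "(nat \<Rightarrow> int) \<Rightarrow> (nat \<Rightarrow> int) \<Rightarrow> 'k::zero poly3 mat \<Rightarrow> bool" where
  "graded_matrix t s A \<longleftrightarrow>
     (\<forall>i<dim_row A. \<forall>j<dim_col A. homogeneous (s j - t i) (A $$ (i, j)))"

definition maximal_minors :: "'a::comm_ring_1 mat \<Rightarrow> 'a set" where
  "maximal_minors A =
     {det (submatrix A UNIV J) | J. J \<subseteq> {..<dim_col A} \<and> card J = dim_row A}"

definition minor_del2 :: "'a::comm_ring_1 mat \<Rightarrow> nat \<Rightarrow> nat \<Rightarrow> 'a" where
  "minor_del2 A r j = det (submatrix A UNIV ({..<dim_col A} - {r, j}))"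

text \<open>
  The matrices of the maps $\varepsilon$ and $\delta$ of the Buchsbaum-Rim complex of \<open>A\<close>.
  With rows and columns counted from 1, the signs are $(-1)^{n-r+1}$ (for $r<j$) and $(-1)^{n-r}$
  (for $r>j$) in $\varepsilon$, and $(-1)^{j+1}$ in $\delta$. The exponents below have the same
  parity after the shift to indices starting at 0, and are never negative.
\<close>

definition br_epsilon :: "'a::comm_ring_1 mat \<Rightarrow> 'a mat" where
  "br_epsilon A = mat (dim_col A) (dim_col A) (\<lambda>(r, j).
     if r < j then (-1) ^ (dim_row A + r) * minor_del2 A r j
     else if r = j then 0
     else (-1) ^ (dim_row A + r + 1) * minor_del2 A r j)"

definition br_delta :: "'a::comm_ring_1 mat \<Rightarrow> 'a mat" where
  "br_delta A = mat (dim_col A) (dim_row A) (\<lambda>(j, i). (-1) ^ j * A $$ (i, j))"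

text \<open>
  Height of a prime ideal: the supremum of the lengths \<open>k\<close> of strict chains
  $P_0 \subset \dots \subset P_k = P$ of primes. The codimension of an ideal is the infimum of the
  heights of the primes containing it (infinite for the unit ideal).
\<close>

definition prime_height :: "('a, 'b) ring_scheme \<Rightarrow> 'a set \<Rightarrow> enat" where
  "prime_height R P = Sup {enat k | k. \<exists>C :: nat \<Rightarrow> 'a set.
     (\<forall>i\<le>k. primeideal (C i) R) \<and> (\<forall>i<k. C i \<subset> C (Suc i)) \<and> C k = P}"

definition codim :: "('a, 'b) ring_scheme \<Rightarrow> 'a set \<Rightarrow> enat" where
  "codim R I = (INF P\<in>{P. primeideal P R \<and> I \<subseteq> P}. prime_height R P)"

end

theory Submission
  imports Defs "Berlekamp_Zassenhaus.Unique_Factorization_Poly"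
begin

text \<open>
  Suppose all \<open>n\<close>-minors avoiding column \<open>j\<close> vanish. Then some nonzero row vector \<open>v\<close>, which may be
  taken without a common prime factor, annihilates every column except the \<open>j\<close>-th one, \<open>w\<close>. Since
  the entries have no constant term, \<open>v \<cdot> w\<close> is not a unit and so has a prime divisor \<open>p\<close>. For each
  square submatrix \<open>B\<close> of full size the entries of \<open>v B\<close> are \<open>0\<close> or \<open>v \<cdot> w\<close>, hence \<open>p\<close> divides all
  entries of \<open>v B adj B = det B v\<close>, and therefore \<open>det B\<close>. So the ideal of maximal minors lies in the
  height-one prime \<open>(p)\<close> and has codimension at most 1. The degree formula follows by comparing the
  degree of a nonzero minor in column \<open>j\<close> with the one imposed by the grading.
\<close>

subsection \<open>Prime factors in the polynomial ring\<close>

text \<open>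
  The number of prime factors, as a size function: it serves in place of greatest common divisors
  and of multiplicities.
\<close>

lemma ufd_factor_count:
  "\<exists>N :: 'a::ufd \<Rightarrow> nat. \<forall>p y. prime_elem p \<longrightarrow> y \<noteq> 0 \<longrightarrow> N y < N (p * y)"
proof -
  \<comment> \<open>Factorizations in \<open>mset_factors\<close> are nonempty, so units get the
    value 0 separately. At 0 the choice is unspecified, which is why \<open>y \<noteq> 0\<close> is
    required.\<close>
  define N :: "'a \<Rightarrow> nat" where "N x = (if x dvd 1 then 0 else size (SOME F. mset_factors F x))" for x
  have N: "N x = size F" if F: "mset_factors F x" for F x
  proof -
    have "mset_factors (SOME F. mset_factors F x) x" using F by (rule someI)
    \<comment> \<open>Two factorizations agree up to order and associates, hence in size.\<close>
    then have "size (SOME F. mset_factors F x) = size F"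
      using F mset_factors_unique rel_mset_size by blast
    then show ?thesis using mset_factors_imp_not_is_unit[OF F] by (simp add: N_def)
  qed
  have "N y < N (p * y)" if p: "prime_elem p" and y: "y \<noteq> 0" for p y
  proof (cases "y dvd 1")
    case True
    then have "irreducible (p * y)"
      using p irreducible_mult_unit_right[OF True] by simp
    then have "mset_factors {#p * y#} (p * y)" by (simp add: mset_factors_def)
    from N[OF this] show ?thesis using True by (simp add: N_def)
  next
    case False
    then obtain F where F: "mset_factors F y" using mset_factors_exist y by blast
    then have "mset_factors (add_mset p F) (p * y)"
      using p by (auto simp: mset_factors_def)
    from N[OF this] N[OF F] show ?thesis by simp
  qed
  then show ?thesis by blast
qed

lemma ufd_prime_divisor:
  fixes x :: "'a::ufd"
  assumes "x \<noteq> 0" "\<not> x dvd 1"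
  shows "\<exists>p. prime_elem p \<and> p dvd x"
proof -
  obtain F where F: "mset_factors F x" using mset_factors_exist assms by blast
  then obtain p where "p \<in># F" unfolding mset_factors_def by auto
  then show ?thesis using F unfolding mset_factors_def
    by (metis prime_elem_iff_irreducible dvd_prod_mset)
qed

section \<open>Exponent vectors and the isomorphism with iterated univariate polynomials\<close>

lemma UNIV_3: "(UNIV :: 3 set) = {0, 1, 2}"
proof -
  have "card ({0, 1, 2} :: 3 set) = 3" by simp
  then have "{0, 1, 2} = (UNIV :: 3 set)" by (intro card_subset_eq) auto
  then show ?thesis by simp
qed

definition exponent :: "nat \<Rightarrow> nat \<Rightarrow> nat \<Rightarrow> (3 \<Rightarrow>\<^sub>0 nat)" where
  "exponent i j k = Poly_Mapping.single 0 i + Poly_Mapping.single 1 j + Poly_Mapping.single 2 k"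

lemma lookup_exponent [simp]:
  "Poly_Mapping.lookup (exponent i j k) 0 = i"
  "Poly_Mapping.lookup (exponent i j k) 1 = j"
  "Poly_Mapping.lookup (exponent i j k) 2 = k"
  by (simp_all add: exponent_def lookup_add lookup_single)

lemma exponent_eq_iff:
  "m = exponent i j k \<longleftrightarrow> Poly_Mapping.lookup m 0 = i \<and> Poly_Mapping.lookup m 1 = j \<and>
     Poly_Mapping.lookup m 2 = k"
proof
  assume R: "Poly_Mapping.lookup m 0 = i \<and> Poly_Mapping.lookup m 1 = j \<and>
     Poly_Mapping.lookup m 2 = k"
  have "Poly_Mapping.lookup m t = Poly_Mapping.lookup (exponent i j k) t" for t
  proof -
    have "t \<in> {0, 1, 2}" using UNIV_3 by blast
    then show ?thesis using R by auto
  qed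
  then show "m = exponent i j k" by (rule poly_mapping_eqI)
qed auto

text \<open>
  Unique factorization is available for iterated univariate polynomials; it is transported to
  \<^typ>\<open>'k poly3\<close> along the isomorphism \<open>nested_poly\<close>.
\<close>

definition nested_monom :: "(3 \<Rightarrow>\<^sub>0 nat) \<Rightarrow> 'k \<Rightarrow> 'k::comm_ring_1 poly poly poly" where
  "nested_monom m c = Polynomial.monom (Polynomial.monom (Polynomial.monom c
     (Poly_Mapping.lookup m 2)) (Poly_Mapping.lookup m 1)) (Poly_Mapping.lookup m 0)"

definition nested_poly :: "'k::comm_ring_1 poly3 \<Rightarrow> 'k poly poly poly" where
  "nested_poly f = (\<Sum>m\<in>Poly_Mapping.keys f. nested_monom m (Poly_Mapping.lookup f m))"

lemma coeff_nested_monom: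
  "poly.coeff (poly.coeff (poly.coeff (nested_monom m c) i) j) k = (if m = exponent i j k then c else 0)"
  by (auto simp: nested_monom_def exponent_eq_iff)

lemma coeff_nested_poly:
  "poly.coeff (poly.coeff (poly.coeff (nested_poly f) i) j) k = Poly_Mapping.lookup f (exponent i j k)"
  by (auto simp: nested_poly_def Polynomial.coeff_sum coeff_nested_monom sum.delta' in_keys_iff)

lemma nested_poly_eqI:
  assumes "\<And>i j k. poly.coeff (poly.coeff (poly.coeff f i) j) k = poly.coeff (poly.coeff (poly.coeff g i) j) k"
  shows "f = g"
  by (intro poly_eqI assms)

lemma nested_poly_add: "nested_poly (f + g) = nested_poly f + nested_poly g"
  by (rule nested_poly_eqI) (simp add: coeff_nested_poly lookup_add)

lemma nested_poly_0: "nested_poly 0 = 0"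
  by (simp add: nested_poly_def)

lemma nested_poly_sum: "nested_poly (sum F S) = (\<Sum>s\<in>S. nested_poly (F s))"
  by (induction S rule: infinite_finite_induct) (simp_all add: nested_poly_add nested_poly_0)

lemma nested_poly_single: "nested_poly (Poly_Mapping.single m c) = nested_monom m c"
  by (rule nested_poly_eqI) (simp add: coeff_nested_poly coeff_nested_monom lookup_single when_def)

lemma nested_poly_1: "nested_poly 1 = 1"
  unfolding single_one[symmetric] nested_poly_single
  by (simp add: nested_monom_def monom_eq_1_iff)

lemma sum_singles:
  fixes f :: "'a \<Rightarrow>\<^sub>0 'b::comm_monoid_add"
  shows "(\<Sum>m\<in>Poly_Mapping.keys f. Poly_Mapping.single m (Poly_Mapping.lookup f m)) = f"
  by (rule poly_mapping_eqI)
    (auto simp: lookup_sum lookup_single when_def sum.delta' in_keys_iff)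

text \<open>By additivity both factors split into single terms, for which exponents add in each of
  the three variables.\<close>

lemma nested_poly_mult: "nested_poly (f * g) = nested_poly f * nested_poly g"
proof -
  let ?F = "\<lambda>m. Poly_Mapping.single m (Poly_Mapping.lookup f m)"
  let ?G = "\<lambda>m. Poly_Mapping.single m (Poly_Mapping.lookup g m)"
  have monom: "nested_poly (?F m * ?G m') = nested_poly (?F m) * nested_poly (?G m')" for m m'
    by (simp add: mult_single nested_poly_single nested_monom_def mult_monom lookup_add)
  have "nested_poly (f * g) = nested_poly (sum ?F (Poly_Mapping.keys f) * sum ?G (Poly_Mapping.keys g))"
    by (simp add: sum_singles)
  also have "\<dots> = nested_poly (sum ?F (Poly_Mapping.keys f)) * nested_poly (sum ?G (Poly_Mapping.keys g))"
    by (simp only: sum_product nested_poly_sum monom)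
  finally show ?thesis by (simp add: sum_singles)
qed

lemma bij_nested_poly: "bij (nested_poly :: 'k::comm_ring_1 poly3 \<Rightarrow> _)"
proof (rule bijI)
  show "inj (nested_poly :: 'k poly3 \<Rightarrow> _)"
  proof (rule injI, rule poly_mapping_eqI)
    fix f g :: "'k poly3" and m
    assume "nested_poly f = nested_poly g"
    moreover have "m = exponent (Poly_Mapping.lookup m 0) (Poly_Mapping.lookup m 1) (Poly_Mapping.lookup m 2)"
      by (simp add: exponent_eq_iff)
    ultimately show "Poly_Mapping.lookup f m = Poly_Mapping.lookup g m"
      by (metis coeff_nested_poly)
  qed
  \<comment> \<open>Expanding \<open>g\<close> in each of its three indeterminates writes it as a
    finite sum of nested monomials.\<close>
  have "\<exists>f. g = nested_poly f" for g :: "'k poly poly poly"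
  proof -
    have "g = (\<Sum>i\<le>degree g. \<Sum>j\<le>degree (poly.coeff g i). \<Sum>k\<le>degree (poly.coeff (poly.coeff g i) j).
       nested_monom (exponent i j k) (poly.coeff (poly.coeff (poly.coeff g i) j) k))"
      by (simp add: nested_monom_def monom_hom.hom_sum[symmetric] poly_as_sum_of_monoms)
    also have "\<dots> = nested_poly (\<Sum>i\<le>degree g. \<Sum>j\<le>degree (poly.coeff g i). \<Sum>k\<le>degree (poly.coeff (poly.coeff g i) j).
       Poly_Mapping.single (exponent i j k) (poly.coeff (poly.coeff (poly.coeff g i) j) k))"
      by (simp only: nested_poly_sum nested_poly_single)
    finally show ?thesis by blast
  qed
  then show "surj (nested_poly :: 'k poly3 \<Rightarrow> _)" by auto
qed

lemma nested_poly_dvd_iff: "nested_poly f dvd nested_poly g \<longleftrightarrow> f dvd g"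
proof
  assume "nested_poly f dvd nested_poly g"
  then obtain c where "nested_poly g = nested_poly f * c" by (elim dvdE)
  moreover obtain d where "c = nested_poly d" using bij_nested_poly by (metis bij_pointE)
  ultimately have "nested_poly g = nested_poly (f * d)" by (simp add: nested_poly_mult)
  then have "g = f * d" using bij_nested_poly by (metis bij_is_inj injD)
  then show "f dvd g" by simp
qed (auto simp: dvd_def nested_poly_mult)

lemma prime_elem_nested_poly_iff: "prime_elem (nested_poly p) \<longleftrightarrow> prime_elem p"
proof -
  have surj: "\<exists>f. g = nested_poly f" for g :: "'a poly poly poly"
    using bij_nested_poly by (metis bij_pointE)
  have "nested_poly p = 0 \<longleftrightarrow> p = 0"
    using bij_nested_poly nested_poly_0 by (metis bij_is_inj injD)
  moreover have "nested_poly p dvd 1 \<longleftrightarrow> p dvd 1"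
    using nested_poly_dvd_iff[of p 1] by (simp add: nested_poly_1)
  moreover have "(\<forall>a b. nested_poly p dvd a * b \<longrightarrow> nested_poly p dvd a \<or> nested_poly p dvd b) \<longleftrightarrow>
      (\<forall>a b. p dvd a * b \<longrightarrow> p dvd a \<or> p dvd b)"
    using surj by (metis nested_poly_dvd_iff nested_poly_mult)
  ultimately show ?thesis by (simp add: prime_elem_def)
qed

lemma poly3_factor_count:
  "\<exists>N :: 'k::field poly3 \<Rightarrow> nat. \<forall>p y. prime_elem p \<longrightarrow> y \<noteq> 0 \<longrightarrow> N y < N (p * y)"
proof -
  obtain N :: "'k poly poly poly \<Rightarrow> nat"
    where N: "\<And>p y. prime_elem p \<Longrightarrow> y \<noteq> 0 \<Longrightarrow> N y < N (p * y)"
    using ufd_factor_count by metis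
  have "N (nested_poly y) < N (nested_poly (p * y))" if "prime_elem p" "y \<noteq> 0" for p y :: "'k poly3"
  proof -
    have "nested_poly y \<noteq> 0"
      using that bij_nested_poly nested_poly_0 by (metis bij_is_inj injD)
    from N[OF iffD2[OF prime_elem_nested_poly_iff that(1)] this] show ?thesis
      by (simp only: nested_poly_mult)
  qed
  then show ?thesis by (intro exI[of _ "\<lambda>y. N (nested_poly y)"]) blast
qed

text \<open>The constant term is the innermost coefficient at 0 of the nested polynomial, where
  multiplicativity is known. It makes every combination of entries without constant term again free
  of one.\<close>

lemma lookup_mult_0:
  fixes f g :: "'k::comm_ring_1 poly3"
  shows "Poly_Mapping.lookup (f * g) 0 = Poly_Mapping.lookup f 0 * Poly_Mapping.lookup g 0"
proof -
  have "Poly_Mapping.lookup h 0 = poly.coeff (poly.coeff (poly.coeff (nested_poly h) 0) 0) 0" for h :: "'k poly3"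
    by (simp add: coeff_nested_poly exponent_def)
  then show ?thesis by (simp add: nested_poly_mult coeff_mult_0)
qed

lemma poly3_prime_divisor:
  fixes f :: "'k::field poly3"
  assumes f: "Poly_Mapping.lookup f 0 = 0"
  shows "\<exists>p. prime_elem p \<and> p dvd f"
proof -
  have "\<exists>q. prime_elem q \<and> q dvd nested_poly f"
  proof (cases "f = 0")
    case True
    \<comment> \<open>Every element divides 0, so any prime will do: the outermost indeterminate is
      a nonunit, as evaluation at 0 shows, and hence has a prime divisor.\<close>
    have "\<not> [:0, 1 :: 'k poly poly:] dvd 1"
    proof
      assume "[:0, 1 :: 'k poly poly:] dvd 1"
      then obtain g where "1 = [:0, 1 :: 'k poly poly:] * g" by (elim dvdE)
      then have "poly 1 0 = poly ([:0, 1 :: 'k poly poly:] * g) 0" by simp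
      then show False by simp
    qed
    with ufd_prime_divisor[of "[:0, 1 :: 'k poly poly:]"] True show ?thesis
      by (auto simp: nested_poly_0)
  next
    case False
    have "exponent 0 0 0 = 0" by (simp add: exponent_def)
    then have f0: "poly.coeff (poly.coeff (poly.coeff (nested_poly f) 0) 0) 0 = 0"
      using f by (simp add: coeff_nested_poly)
    have "\<not> nested_poly f dvd 1"
    proof
      assume "nested_poly f dvd 1"
      then obtain g where "1 = nested_poly f * g" by (elim dvdE)
      then have "poly.coeff (poly.coeff (poly.coeff 1 0) 0) 0 =
          poly.coeff (poly.coeff (poly.coeff (nested_poly f * g) 0) 0) 0" by simp
      then show False using f0 by (simp add: coeff_mult_0)
    qed
    moreover have "nested_poly f \<noteq> 0"
      using False bij_nested_poly nested_poly_0 by (metis bij_is_inj injD)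
    ultimately show ?thesis by (rule ufd_prime_divisor[rotated])
  qed
  then obtain q where q: "prime_elem q" "q dvd nested_poly f" by (elim exE conjE)
  obtain p where p: "q = nested_poly p" using bij_nested_poly by (metis bij_pointE)
  have "prime_elem p"
    using q(1) unfolding p by (rule iffD1[OF prime_elem_nested_poly_iff])
  moreover have "p dvd f"
    using q(2) unfolding p by (rule iffD1[OF nested_poly_dvd_iff])
  ultimately show ?thesis by (intro exI[of _ p] conjI)
qed

subsection \<open>Annihilating vectors and minors\<close>

text \<open>This is the rank criterion over the fraction field, kept free of denominators by using
  cofactors. The map \<open>f\<close> selects columns from \<open>C\<close>, repetitions allowed;
  the induction adds one row at a time.\<close>

lemma exists_left_null_vector:
  fixes A :: "nat \<Rightarrow> nat \<Rightarrow> 'a::idom"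
  assumes "\<And>f. \<forall>j<n. f j \<in> C \<Longrightarrow> det (mat n n (\<lambda>(i, j). A i (f j))) = 0"
  shows "\<exists>v. (\<exists>i<n. v i \<noteq> 0) \<and> (\<forall>c\<in>C. (\<Sum>i<n. v i * A i c) = 0)"
  using assms
proof (induction n)
  case 0
  \<comment> \<open>The empty determinant is 1, so the hypothesis is contradictory.\<close>
  then show ?case by force
next
  case (Suc n)
  show ?case
  proof (cases "\<forall>f. (\<forall>j<n. f j \<in> C) \<longrightarrow> det (mat n n (\<lambda>(i, j). A i (f j))) = 0")
    case True
    then obtain v where v: "\<exists>i<n. v i \<noteq> 0" "\<forall>c\<in>C. (\<Sum>i<n. v i * A i c) = 0"
      using Suc.IH by blast
    then show ?thesis
      by (intro exI[of _ "v(n := 0)"]) (auto simp: lessThan_Suc)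
  next
    case False
    then obtain f where f: "\<forall>j<n. f j \<in> C" and D: "det (mat n n (\<lambda>(i, j). A i (f j))) \<noteq> 0"
      by blast
    text \<open>
      Append a column \<open>c\<close> to a nonvanishing minor of the first \<open>n\<close> rows: the cofactors along that
      column do not depend on \<open>c\<close> and form the required vector.
    \<close>
    define B where "B c = mat (Suc n) (Suc n) (\<lambda>(i, j). A i ((f(n := c)) j))" for c
    \<comment> \<open>The column 0 is a placeholder and need not lie in \<open>C\<close>.\<close>
    define v where "v i = cofactor (B 0) i n" for i
    have cofactor_B: "cofactor (B c) i n = v i" if "i < Suc n" for c i
    proof -
      have "mat_delete (B c) i n = mat_delete (B 0) i n"
        using that by (intro eq_matI) (auto simp: mat_delete_def B_def)
      then show ?thesis by (simp add: v_def cofactor_def)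
    qed
    have "(\<Sum>i<Suc n. v i * A i c) = 0" if "c \<in> C" for c
    proof -
      have "0 = det (B c)"
        unfolding B_def using f that by (intro Suc.prems[symmetric]) auto
      also have "\<dots> = (\<Sum>i<Suc n. B c $$ (i, n) * cofactor (B c) i n)"
        by (rule laplace_expansion_column) (auto simp: B_def)
      also have "\<dots> = (\<Sum>i<Suc n. v i * A i c)"
        by (rule sum.cong) (auto simp: cofactor_B, auto simp: B_def)
      finally show ?thesis by simp
    qed
    \<comment> \<open>The last cofactor is, with sign +1, the nonvanishing minor chosen
      above.\<close>
    moreover have "v n \<noteq> 0"
    proof -
      have "mat_delete (B 0) n n = mat n n (\<lambda>(i, j). A i (f j))"
        by (intro eq_matI) (auto simp: mat_delete_def B_def)
      then show ?thesis using D by (simp add: v_def cofactor_def)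
    qed
    ultimately show ?thesis by (intro exI[of _ v]) auto
  qed
qed

text \<open>This is component \<open>i\<close> of \<open>v B adj B = det B v\<close>. It turns
  information on the entries of \<open>v B\<close> into information on \<open>det B\<close>.\<close>

lemma det_mult_left_vector:
  fixes B :: "'a::comm_ring_1 mat"
  assumes B: "B \<in> carrier_mat n n" and i: "i < n"
  shows "v i * det B = (\<Sum>k<n. (\<Sum>l<n. v l * B $$ (l, k)) * adj_mat B $$ (k, i))"
proof -
  have entry: "(\<Sum>k<n. B $$ (l, k) * adj_mat B $$ (k, i)) = (if l = i then det B else 0)"
    if "l < n" for l
  proof -
    have "(B * adj_mat B) $$ (l, i) = (\<Sum>k<n. B $$ (l, k) * adj_mat B $$ (k, i))"
      using B adj_mat(1)[OF B] i that by (auto simp: scalar_prod_def lessThan_atLeast0)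
    then show ?thesis using adj_mat(2)[OF B] i that by auto
  qed
  have "(\<Sum>k<n. (\<Sum>l<n. v l * B $$ (l, k)) * adj_mat B $$ (k, i))
      = (\<Sum>l<n. \<Sum>k<n. v l * (B $$ (l, k) * adj_mat B $$ (k, i)))"
    unfolding sum_distrib_right by (subst sum.swap) (simp add: mult.assoc)
  also have "\<dots> = (\<Sum>l<n. v l * (if l = i then det B else 0))"
    unfolding sum_distrib_left[symmetric] by (intro sum.cong) (auto simp: entry)
  also have "\<dots> = v i * det B"
    using i by (simp add: if_distrib sum.delta' cong: if_cong)
  finally show ?thesis ..
qed

lemma minors_common_prime_divisor:
  fixes A :: "nat \<Rightarrow> nat \<Rightarrow> 'a::idom" and N :: "'a \<Rightarrow> nat"
  assumes N: "\<And>p y. prime_elem p \<Longrightarrow> y \<noteq> 0 \<Longrightarrow> N y < N (p * y)"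
    and minors: "\<And>f. \<forall>j<n. f j \<in> C \<Longrightarrow> det (mat n n (\<lambda>(i, j). A i (f j))) = 0"
    and prime_divisor: "\<And>v. \<exists>p. prime_elem p \<and> p dvd (\<Sum>i<n. v i * A i c0)"
  shows "\<exists>p. prime_elem p \<and>
    (\<forall>f. (\<forall>j<n. f j \<in> insert c0 C) \<longrightarrow> p dvd det (mat n n (\<lambda>(i, j). A i (f j))))"
proof -
  text \<open>Minimality of \<open>N (v i)\<close> makes \<open>v\<close> free of common prime factors.\<close>
  let ?null = "\<lambda>v. \<forall>c\<in>C. (\<Sum>i<n. v i * A i c) = 0"
  define P where "P = (\<lambda>(v, i). i < n \<and> v i \<noteq> 0 \<and> ?null v)"
  obtain v0 i0 where "P (v0, i0)"
    using exists_left_null_vector[of n C A, OF minors] by (auto simp: P_def)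
  then have "\<exists>x. P x \<and> (\<forall>y. P y \<longrightarrow> (\<lambda>(v, i). N (v i)) x \<le> (\<lambda>(v, i). N (v i)) y)"
    by (rule ex_has_least_nat)
  then obtain v i where P: "P (v, i)" and P_least: "\<And>u. P (u, i) \<Longrightarrow> N (v i) \<le> N (u i)"
    by fastforce
  from P have i: "i < n" and vi: "v i \<noteq> 0" and null: "?null v"
    by (simp_all add: P_def)
  have least: "N (v i) \<le> N (u i)" if "u i \<noteq> 0" "?null u" for u
    using P_least[of u] i that unfolding P_def by simp
  from prime_divisor[of v] obtain p
    where p: "prime_elem p" and p_dvd: "p dvd (\<Sum>i<n. v i * A i c0)"
    by (elim exE conjE)
  \<comment> \<open>Otherwise dividing \<open>v\<close> by \<open>p\<close> gives another null
    vector, whose entry at \<open>i\<close> is nonzero with a smaller value of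
    \<open>N\<close>.\<close>
  have "\<exists>k<n. \<not> p dvd v k"
  proof (rule ccontr)
    assume "\<not> ?thesis"
    then have "\<forall>k. \<exists>u. k < n \<longrightarrow> v k = p * u" by (auto elim!: dvdE)
    then obtain u where u: "\<And>k. k < n \<Longrightarrow> v k = p * u k" by metis
    have "?null u"
    proof
      fix c assume "c \<in> C"
      then have "0 = (\<Sum>i<n. v i * A i c)" using null by simp
      also have "\<dots> = p * (\<Sum>i<n. u i * A i c)"
        by (simp add: u sum_distrib_left mult.assoc)
      finally show "(\<Sum>i<n. u i * A i c) = 0" using p by (auto simp: prime_elem_def)
    qed
    moreover have "u i \<noteq> 0" using u[OF i] vi by auto
    ultimately show False using least N[OF p] u[OF i] by (metis leD)
  qed
  then obtain k where k: "k < n" "\<not> p dvd v k" by blast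
  have "p dvd det (mat n n (\<lambda>(i, j). A i (f j)))" if f: "\<forall>j<n. f j \<in> insert c0 C" for f
  proof -
    let ?B = "mat n n (\<lambda>(i, j). A i (f j))"
    \<comment> \<open>Columns from \<open>C\<close> contribute 0, the column \<open>c0\<close>
      contributes the multiple of \<open>p\<close> fixed above.\<close>
    have entry: "p dvd (\<Sum>l<n. v l * ?B $$ (l, j))" if "j < n" for j
      using f that null p_dvd by (auto simp: insert_iff)
    have "p dvd (\<Sum>j<n. (\<Sum>l<n. v l * ?B $$ (l, j)) * adj_mat ?B $$ (j, k))"
      by (intro dvd_sum dvd_mult2 entry) simp
    then have "p dvd v k * det ?B"
      using k(1) by (subst det_mult_left_vector[where n = n]) simp_all
    then show ?thesis using k(2) p by (simp add: prime_elem_dvd_mult_iff)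
  qed
  with p show ?thesis by (intro exI[of _ p] conjI allI impI)
qed

text \<open>In contrast to \<open>exists_left_null_vector\<close>, a single vanishing determinant is
  given; transposition reduces this to the known criterion for right null vectors.\<close>

lemma det_0_imp_left_null_vector:
  fixes M :: "nat \<Rightarrow> nat \<Rightarrow> 'a::idom"
  assumes "det (mat n n (\<lambda>(i, j). M i j)) = 0"
  shows "\<exists>u. (\<exists>i<n. u i \<noteq> 0) \<and> (\<forall>j<n. (\<Sum>i<n. u i * M i j) = 0)"
proof -
  let ?B = "transpose_mat (mat n n (\<lambda>(i, j). M i j))"
  have B: "?B \<in> carrier_mat n n" by simp
  have "det ?B = 0" using assms by (subst det_transpose) auto
  then obtain v where v: "v \<in> carrier_vec n" "v \<noteq> 0\<^sub>v n" "?B *\<^sub>v v = 0\<^sub>v n"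
    using det_0_iff_vec_prod_zero[OF B] by auto
  have "(\<Sum>i<n. v $ i * M i j) = 0" if "j < n" for j
  proof -
    have "(?B *\<^sub>v v) $ j = (\<Sum>i<n. M i j * v $ i)"
      using v(1) that by (auto simp: scalar_prod_def lessThan_atLeast0)
    then show ?thesis using v(3) that by (simp add: mult.commute)
  qed
  moreover have "\<exists>i<n. v $ i \<noteq> 0" using v(1,2) by (metis eq_vecI carrier_vecD index_zero_vec)
  ultimately show ?thesis by blast
qed

text \<open>Since \<open>pick J\<close> enumerates \<open>J\<close> increasingly, every maximal
  minor becomes a determinant for a column selection \<open>f\<close>, the form used above.\<close>

lemma submatrix_UNIV_eq:
  assumes "J \<subseteq> {..<dim_col A}" "card J = dim_row A"
  shows "submatrix A UNIV J = mat (dim_row A) (dim_row A) (\<lambda>(i, j). A $$ (i, pick J j))"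
proof -
  have J: "{j. j < dim_col A \<and> j \<in> J} = J" using assms(1) by blast
  show ?thesis unfolding submatrix_def J assms(2) by (simp add: pick_UNIV)
qed

lemma bij_betw_pick:
  assumes "finite J"
  shows "bij_betw (pick J) {..<card J} J"
proof -
  have "inj_on (pick J) {..<card J}"
    by (rule inj_onI) (metis lessThan_iff nat_neq_iff pick_mono_le)
  moreover have "pick J ` {..<card J} \<subseteq> J" using pick_in_set_le by auto
  ultimately show ?thesis
    by (intro bij_betw_imageI card_subset_eq assms) (simp_all add: card_image)
qed

text \<open>The selection \<open>f\<close> may repeat or reorder columns. It hits at most
  \<open>n\<close> of the \<open>n + 1\<close> columns other than \<open>j\<close>, so it misses
  some \<open>r\<close>; a left null vector of the minor deleting \<open>r\<close> and
  \<open>j\<close> then annihilates all selected columns.\<close>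

lemma det_eq_0_if_minor_del2_eq_0:
  fixes A :: "'a::idom mat"
  assumes A: "A \<in> carrier_mat n (n + 2)" and j: "j < n + 2"
    and minors: "\<And>r. r < n + 2 \<Longrightarrow> r \<noteq> j \<Longrightarrow> minor_del2 A r j = 0"
    and f: "\<forall>k<n. f k \<in> {..<n + 2} - {j}"
  shows "det (mat n n (\<lambda>(i, k). A $$ (i, f k))) = 0"
proof -
  have "card (f ` {..<n}) < card ({..<n + 2} - {j})"
    using card_image_le[of "{..<n}" f] j by simp
  then have "\<not> {..<n + 2} - {j} \<subseteq> f ` {..<n}"
    by (metis card_mono finite_imageI finite_lessThan leD)
  then obtain r where r: "r < n + 2" "r \<noteq> j" "r \<notin> f ` {..<n}" by auto
  define J where "J = {..<n + 2} - {r, j}"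
  have J: "finite J" "card J = n" "J \<subseteq> {..<n + 2}"
    using r j by (auto simp: J_def card_Diff_subset)
  have "det (mat n n (\<lambda>(i, k). A $$ (i, pick J k))) = 0"
    using minors[OF r(1,2)] submatrix_UNIV_eq[of J A] J A
    by (simp add: minor_del2_def J_def)
  then obtain u where u: "\<exists>i<n. u i \<noteq> 0" "\<forall>k<n. (\<Sum>i<n. u i * A $$ (i, pick J k)) = 0"
    using det_0_imp_left_null_vector[of n "\<lambda>i k. A $$ (i, pick J k)"] by auto
  have null: "(\<Sum>i<n. u i * A $$ (i, f k)) = 0" if "k < n" for k
  proof -
    have "f k \<in> J" using f r(3) that by (auto simp: J_def)
    then have "f k \<in> pick J ` {..<n}" using bij_betw_pick[OF J(1)] J(2) by (simp add: bij_betw_def)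
    then show ?thesis using u(2) by auto
  qed
  obtain i where i: "i < n" "u i \<noteq> 0" using u(1) by blast
  have "u i * det (mat n n (\<lambda>(i, k). A $$ (i, f k))) = 0"
    using i(1) by (subst det_mult_left_vector[where n = n]) (simp_all add: null)
  then show ?thesis using i(2) by simp
qed

subsection \<open>Codimension\<close>

lemma primeideal_principal:
  fixes p :: "'a::idom"
  assumes p: "prime_elem p"
  shows "primeideal {x. p dvd x} class_ring"
proof (rule primeidealI)
  show "ideal {x. p dvd x} class_ring"
  proof (rule idealI)
    show "ring (class_ring :: 'a ring)" by (rule class_ring.ring_axioms)
    have inv: "m_inv (add_monoid class_ring) x = - x" for x :: 'a
      unfolding a_inv_def[symmetric] by (simp only: class_ring_simps)
    show "subgroup {x. p dvd x} (add_monoid class_ring)"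
    proof (rule subgroup.intro)
      fix x assume "x \<in> {x. p dvd x}"
      then show "m_inv (add_monoid class_ring) x \<in> {x. p dvd x}"
        unfolding inv by simp
    qed auto
  qed auto
  show "cring (class_ring :: 'a ring)" by (rule class_cring.cring_axioms)
  show "carrier class_ring \<noteq> {x. p dvd x}"
    using p by (auto simp: prime_elem_def)
qed (use p in \<open>auto simp: prime_elem_def\<close>)

text \<open>A nonzero prime \<open>Q\<close> inside \<open>(p)\<close> contains \<open>p\<close>:
  write a nonzero element of \<open>Q\<close> as \<open>p * y\<close>; either \<open>p\<close> or
  \<open>y\<close> lies in \<open>Q\<close>, and replacing the element by \<open>y\<close> lowers
  \<open>N\<close>.\<close>

lemma prime_height_principal_le:
  fixes p :: "'a::idom" and N :: "'a \<Rightarrow> nat"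
  assumes N: "\<And>p y. prime_elem p \<Longrightarrow> y \<noteq> 0 \<Longrightarrow> N y < N (p * y)"
    and p: "prime_elem p"
  shows "prime_height class_ring {x. p dvd x} \<le> 1"
  unfolding prime_height_def
proof (rule Sup_least, clarify)
  fix k and C :: "nat \<Rightarrow> 'a set"
  assume prime: "\<forall>i\<le>k. primeideal (C i) class_ring" and chain: "\<forall>i<k. C i \<subset> C (Suc i)"
    and top: "C k = {x. p dvd x}"
  show "enat k \<le> 1"
  proof (rule ccontr)
    assume "\<not> enat k \<le> 1"
    \<comment> \<open>A chain of length at least 2 ends in two primes strictly below one another and
      below \<open>(p)\<close>.\<close>
    then obtain k' where k: "k = Suc (Suc k')"
      by (cases k rule: nat.exhaust; cases "k - 1") (auto simp: one_enat_def)
    let ?Q = "C (Suc k')"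
    interpret P0: primeideal "C k'" class_ring using prime k by simp
    interpret Q: primeideal ?Q class_ring using prime k by simp
    \<comment> \<open>The lower prime contains 0, so strictness yields a nonzero element of the
      upper one.\<close>
    have "0 \<in> C k'" using P0.zero_closed by simp
    then obtain q where q: "q \<in> ?Q" "q \<noteq> 0" using chain k by (metis psubset_imp_ex_mem lessI less_SucI DiffE)
    have sub: "?Q \<subset> {x. p dvd x}" using chain k top by (metis lessI)
    have "x \<in> ?Q \<Longrightarrow> x \<noteq> 0 \<Longrightarrow> p \<in> ?Q" for x
    proof (induction "N x" arbitrary: x rule: less_induct)
      case less
      obtain y where y: "x = p * y" using sub less.prems by (auto elim: dvdE)
      then have "y \<noteq> 0" using less.prems by auto
      then show ?case
        using Q.I_prime[of p y] less y N[OF p, of y] by auto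
    qed
    then have "p \<in> ?Q" using q by blast
    then have "{x. p dvd x} \<subseteq> ?Q"
      using Q.I_r_closed by (auto elim!: dvdE)
    with sub show False by blast
  qed
qed

text \<open>The prime ideal \<open>(p)\<close> contains the generated ideal, so its height bounds
  the infimum defining the codimension.\<close>

lemma codim_genideal_le_1:
  fixes p :: "'a::idom" and N :: "'a \<Rightarrow> nat"
  assumes N: "\<And>p y. prime_elem p \<Longrightarrow> y \<noteq> 0 \<Longrightarrow> N y < N (p * y)"
    and p: "prime_elem p" and S: "\<And>x. x \<in> S \<Longrightarrow> p dvd x"
  shows "codim class_ring (genideal class_ring S) \<le> 1"
proof -
  have prime: "primeideal {x. p dvd x} class_ring" by (rule primeideal_principal[OF p])
  then have "ideal {x. p dvd x} class_ring" by (rule primeideal.axioms)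
  then have "genideal class_ring S \<subseteq> {x. p dvd x}"
    using S by (intro ring.genideal_minimal[OF class_ring.ring_axioms]) auto
  then have "codim class_ring (genideal class_ring S) \<le> prime_height class_ring {x. p dvd x}"
    unfolding codim_def using prime by (intro INF_lower) auto
  also have "\<dots> \<le> 1" by (rule prime_height_principal_le[OF N p])
  finally show ?thesis .
qed

subsection \<open>Homogeneous polynomials and minors\<close>

lemma homogeneous_0: "homogeneous e 0"
  by (simp add: homogeneous_def)

lemma homogeneous_add:
  "homogeneous e f \<Longrightarrow> homogeneous e g \<Longrightarrow> homogeneous e (f + g)"
  using Poly_Mapping.keys_add[of f g] unfolding homogeneous_def by blast

lemma homogeneous_sum:
  "(\<And>s. s \<in> S \<Longrightarrow> homogeneous e (f s)) \<Longrightarrow> homogeneous e (sum f S)"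
  by (induction S rule: infinite_finite_induct) (auto simp: homogeneous_0 homogeneous_add)

lemma homogeneous_1: "homogeneous 0 (1 :: 'k::zero_neq_one poly3)"
  unfolding single_one[symmetric] homogeneous_def by (simp add: monom_degree_def)

lemma homogeneous_mult:
  fixes f g :: "'k::comm_ring_1 poly3"
  assumes "homogeneous d f" "homogeneous e g"
  shows "homogeneous (d + e) (f * g)"
  unfolding homogeneous_def
proof
  fix m assume "m \<in> Poly_Mapping.keys (f * g)"
  then obtain s t where st: "s \<in> Poly_Mapping.keys f" "t \<in> Poly_Mapping.keys g" "m = s + t"
    using keys_mult[of f g] by auto
  then have "int (monom_degree m) = int (monom_degree s) + int (monom_degree t)"
    by (simp add: monom_degree_def lookup_add sum.distrib)
  then show "int (monom_degree m) = d + e"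
    using assms st by (simp add: homogeneous_def)
qed

lemma homogeneous_prod:
  fixes f :: "'a \<Rightarrow> 'k::comm_ring_1 poly3"
  assumes "finite S" "\<And>s. s \<in> S \<Longrightarrow> homogeneous (e s) (f s)"
  shows "homogeneous (sum e S) (prod f S)"
  using assms by (induction S rule: finite_induct) (simp_all add: homogeneous_1 homogeneous_mult)

lemma homogeneous_uminus_iff:
  fixes f :: "'k::comm_ring_1 poly3"
  shows "homogeneous e (- f) \<longleftrightarrow> homogeneous e f"
  by (simp add: homogeneous_def in_keys_iff Ball_def)

lemma homogeneous_minus_one_power_mult_iff:
  fixes f :: "'k::comm_ring_1 poly3"
  shows "homogeneous e ((-1) ^ k * f) \<longleftrightarrow> homogeneous e f"
  by (cases "even k") (simp_all add: homogeneous_uminus_iff)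

lemma homogeneous_unique:
  assumes "homogeneous d f" "homogeneous e f" "f \<noteq> 0"
  shows "d = e"
proof -
  obtain m where "m \<in> Poly_Mapping.keys f" using assms(3) by (metis keys_eq_empty equals0I)
  then show ?thesis using assms(1,2) by (auto simp: homogeneous_def)
qed

text \<open>In the Leibniz expansion a permutation only reorders the column degrees, so all terms
  have the same degree.\<close>

lemma homogeneous_maximal_minor:
  fixes A :: "'k::comm_ring_1 poly3 mat"
  assumes A: "A \<in> carrier_mat n m" and graded: "graded_matrix a b A"
    and J: "J \<subseteq> {..<m}" "card J = n"
  shows "homogeneous ((\<Sum>k\<in>J. b k) - (\<Sum>i<n. a i)) (det (submatrix A UNIV J))"
proof -
  have fin: "finite J" using J(1) finite_subset by blast
  let ?B = "mat n n (\<lambda>(i, k). A $$ (i, pick J k))"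
  have term_homogeneous: "homogeneous ((\<Sum>k\<in>J. b k) - (\<Sum>i<n. a i)) (signof p * (\<Prod>i = 0..<n. ?B $$ (i, p i)))"
    if p: "p permutes {0..<n}" for p
  proof -
    have pi: "p i < n" if "i < n" for i using permutes_in_image[OF p, of i] that by simp
    have entry: "homogeneous (b (pick J (p i)) - a i) (?B $$ (i, p i))" if "i \<in> {0..<n}" for i
    proof -
      have "pick J (p i) \<in> J" using pick_in_set_le J(2) pi that by auto
      then show ?thesis using graded A J(1) pi that by (auto simp: graded_matrix_def)
    qed
    have "(\<Sum>i = 0..<n. b (pick J (p i)) - a i) = (\<Sum>i = 0..<n. b (pick J (p i))) - (\<Sum>i<n. a i)"
      by (simp add: sum_subtractf lessThan_atLeast0)
    also have "(\<Sum>i = 0..<n. b (pick J (p i))) = (\<Sum>i = 0..<n. b (pick J i))"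
      using sum.permute[OF p, of "\<lambda>i. b (pick J i)"] by (simp add: comp_def)
    also have "\<dots> = (\<Sum>k\<in>J. b k)"
      using sum.reindex_bij_betw[OF bij_betw_pick[OF fin], of b] J(2) by (simp add: lessThan_atLeast0)
    finally have "homogeneous ((\<Sum>k\<in>J. b k) - (\<Sum>i<n. a i)) (\<Prod>i = 0..<n. ?B $$ (i, p i))"
      using homogeneous_prod[of "{0..<n}" "\<lambda>i. b (pick J (p i)) - a i" "\<lambda>i. ?B $$ (i, p i)"] entry
      by simp
    then show ?thesis by (cases p rule: sign_cases) (simp_all add: homogeneous_uminus_iff)
  qed
  have "det (submatrix A UNIV J) = det ?B"
    using submatrix_UNIV_eq[of J A] A J by simp
  also have "\<dots> = (\<Sum>p\<in>{p. p permutes {0..<n}}. signof p * (\<Prod>i = 0..<n. ?B $$ (i, p i)))"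
    by (rule det_def') simp
  finally have det: "det (submatrix A UNIV J) =
    (\<Sum>p\<in>{p. p permutes {0..<n}}. signof p * (\<Prod>i = 0..<n. ?B $$ (i, p i)))" .
  show ?thesis
    unfolding det by (rule homogeneous_sum) (rule term_homogeneous, simp)
qed

section \<open>The nonvanishing minor and the degree formula\<close>

lemma exists_minor_del2_nonzero:
  fixes \<phi> :: "'k::field poly3 mat"
  assumes \<phi>: "\<phi> \<in> carrier_mat n (n + 2)"
    and const: "\<And>i j. i < n \<Longrightarrow> j < n + 2 \<Longrightarrow> Poly_Mapping.lookup (\<phi> $$ (i, j)) 0 = 0"
    and codim: "codim class_ring (genideal class_ring (maximal_minors \<phi>)) > 1"
    and j: "j < n + 2"
  shows "\<exists>r<n + 2. r \<noteq> j \<and> minor_del2 \<phi> r j \<noteq> 0"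
proof (rule ccontr)
  assume "\<not> ?thesis"
  then have minors: "minor_del2 \<phi> r j = 0" if "r < n + 2" "r \<noteq> j" for r using that by blast
  obtain N :: "'k poly3 \<Rightarrow> nat" where N: "\<And>p y. prime_elem p \<Longrightarrow> y \<noteq> 0 \<Longrightarrow> N y < N (p * y)"
    using poly3_factor_count by metis
  have vanish: "det (mat n n (\<lambda>(i, k). \<phi> $$ (i, f k))) = 0"
    if "\<forall>k<n. f k \<in> {..<n + 2} - {j}" for f
    using \<phi> j minors that by (rule det_eq_0_if_minor_del2_eq_0)
  have prime_divisor: "\<exists>p. prime_elem p \<and> p dvd (\<Sum>i<n. v i * \<phi> $$ (i, j))" for v
    by (rule poly3_prime_divisor)
      (auto simp: lookup_sum lookup_mult_0 const[OF _ j] intro!: sum.neutral)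
  \<comment> \<open>With \<open>C\<close> the columns other than \<open>j\<close>, inserting
    \<open>j\<close> restores all columns, so the conclusion covers every maximal minor.\<close>
  have "\<exists>p. prime_elem p \<and> (\<forall>f. (\<forall>k<n. f k \<in> insert j ({..<n + 2} - {j})) \<longrightarrow>
      p dvd det (mat n n (\<lambda>(i, k). \<phi> $$ (i, f k))))"
    by (rule minors_common_prime_divisor[where A = "\<lambda>i k. \<phi> $$ (i, k)", OF N vanish prime_divisor])
  then obtain p where p: "prime_elem p"
    and dvd: "\<And>f. \<forall>k<n. f k \<in> insert j ({..<n + 2} - {j}) \<Longrightarrow>
      p dvd det (mat n n (\<lambda>(i, k). \<phi> $$ (i, f k)))"
    by (elim exE conjE) iprover
  have minor_dvd: "p dvd x" if x: "x \<in> maximal_minors \<phi>" for x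
  proof -
    obtain J where J: "J \<subseteq> {..<n + 2}" "card J = n" "x = det (submatrix \<phi> UNIV J)"
      using x \<phi> by (auto simp: maximal_minors_def)
    have "p dvd det (mat n n (\<lambda>(i, k). \<phi> $$ (i, pick J k)))"
      using pick_in_set_le[of _ J] J by (intro dvd) auto
    then show ?thesis using submatrix_UNIV_eq[of J \<phi>] J \<phi> by simp
  qed
  have "codim class_ring (genideal class_ring (maximal_minors \<phi>)) \<le> 1"
    by (rule codim_genideal_le_1[where N = N and p = p, OF N p minor_dvd])
  with codim show False by (simp add: leD)
qed

theorem lemma2p4:
  fixes \<phi> :: "'k::alg_closed_field poly3 mat"
    and a b :: "nat \<Rightarrow> int"
    and n :: nat
  assumes "n > 0"
    and "mono_on {..<n} a"
    and "mono_on {..<n + 2} b"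
    and "\<phi> \<in> carrier_mat n (n + 2)"
    and "graded_matrix a b \<phi>"
    and "\<And>i j. i < n \<Longrightarrow> j < n + 2 \<Longrightarrow> \<phi> $$ (i, j) \<noteq> 0 \<Longrightarrow> b j - a i > 0"
    and "codim class_ring (genideal class_ring (maximal_minors \<phi>)) = 3"
  shows "(\<forall>j<n + 2. \<exists>r<n + 2. r \<noteq> j \<and> minor_del2 \<phi> r j \<noteq> 0) \<and>
    (\<forall>c d :: nat \<Rightarrow> int.
       graded_matrix b c (br_epsilon \<phi>) \<and> graded_matrix c d (br_delta \<phi>) \<longrightarrow>
       (\<forall>j<n + 2. c j = ((\<Sum>k<n + 2. b k) - (\<Sum>i<n. a i)) - b j))"
proof -
  \<comment> \<open>The monomial 1 has degree 0, while a nonzero entry is homogeneous of positive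
    degree.\<close>
  have const: "Poly_Mapping.lookup (\<phi> $$ (i, j)) 0 = 0" if ij: "i < n" "j < n + 2" for i j
  proof (rule ccontr)
    assume "Poly_Mapping.lookup (\<phi> $$ (i, j)) 0 \<noteq> 0"
    then have "0 \<in> Poly_Mapping.keys (\<phi> $$ (i, j))" by (simp add: in_keys_iff)
    moreover from this have "\<phi> $$ (i, j) \<noteq> 0" by auto
    ultimately show False
      using assms(4,5) assms(6)[OF ij] ij
      by (fastforce simp: graded_matrix_def homogeneous_def monom_degree_def)
  qed
  have codim: "codim class_ring (genideal class_ring (maximal_minors \<phi>)) > 1"
    unfolding assms(7) by (simp add: numeral_eq_enat one_enat_def)
  have nonzero: "\<exists>r<n + 2. r \<noteq> j \<and> minor_del2 \<phi> r j \<noteq> 0" if "j < n + 2" for j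
    using assms(4) const codim that by (rule exists_minor_del2_nonzero)
  have "c j = ((\<Sum>k<n + 2. b k) - (\<Sum>i<n. a i)) - b j"
    if c: "graded_matrix b c (br_epsilon \<phi>)" and j: "j < n + 2" for c j
  proof -
    \<comment> \<open>Only a nonzero entry determines its degree, so the formula is read off from a
      row \<open>r\<close> where column \<open>j\<close> of \<epsilon> does not vanish.\<close>
    obtain r where r: "r < n + 2" "r \<noteq> j" "minor_del2 \<phi> r j \<noteq> 0" using nonzero[OF j] by blast
    have "homogeneous (c j - b r) (br_epsilon \<phi> $$ (r, j))"
      using c r(1) j assms(4) by (simp add: graded_matrix_def br_epsilon_def)
    then have "homogeneous (c j - b r) (minor_del2 \<phi> r j)"
      using r(1,2) j assms(4)
      by (auto simp: br_epsilon_def homogeneous_minus_one_power_mult_iff homogeneous_uminus_iff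
          split: if_splits)
    moreover have "homogeneous ((\<Sum>k\<in>{..<n + 2} - {r, j}. b k) - (\<Sum>i<n. a i)) (minor_del2 \<phi> r j)"
      using homogeneous_maximal_minor[OF assms(4,5), of "{..<n + 2} - {r, j}"] r(1,2) j assms(4)
      by (auto simp: minor_del2_def card_Diff_subset)
    ultimately have "c j - b r = (\<Sum>k\<in>{..<n + 2} - {r, j}. b k) - (\<Sum>i<n. a i)"
      using r(3) homogeneous_unique by blast
    \<comment> \<open>With \<open>d\<close> the total degree difference, the minor has degree
      \<open>d - b r - b j\<close>; equating this with \<open>c j - b r\<close> cancels
      \<open>b r\<close>.\<close>
    moreover have "(\<Sum>k<n + 2. b k) = b r + b j + (\<Sum>k\<in>{..<n + 2} - {r, j}. b k)"
      using r(1,2) j sum.subset_diff[of "{r, j}" "{..<n + 2}" b] by simp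
    ultimately show ?thesis by simp
  qed
  with nonzero show ?thesis by blast
qed

end
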